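(* Let $\mathbf{E}$ be a Euclidean space with closed unit ball $B$, let $F, C \subset \mathbf{E}$ be closed sets, and let $\bar x \in F \cap C$. Suppose $C$ is super-regular at $\bar x$ and that $F$ and $C$ have strongly regular intersection at $\bar x$, that is, $N_F(\bar x)\cap -N_C(\bar x)=\{0\}$, or equivalently the constant $$\bar c = \max\{ \langle u, v\rangle : u \in N_F(\bar x) \cap B,\ v \in -N_C(\bar x) \cap B \}$$ is strictly less than one. Fix any constant $c \in (\bar c,1)$ and any constant $\epsilon$ with $0 \le \epsilon < \sqrt{1-c^2}$. Consider the following inexact alternating projection iteration: given initial points $x_0 \in C$ and $x_1 \in F$, for $n=1,2,3,\ldots$ suppose $$x_{2n} \in P_C(x_{2n-1})$$ and $x_{2n+1} \in F$ satisfies $$\|x_{2n+1}-x_{2n}\| \le \|x_{2n}-x_{2n-1}\| \quad\text{and}\quad d_{N_F(x_{2n+1})}\Big(\frac{x_{2n}-x_{2n+1}}{\|x_{2n}-x_{2n+1}\|}\Big) \le \epsilon$$ (the second condition being required only when $x_{2n+1} \ne x_{2n}$). Then, provided $x_0$ and $x_1$ are sufficiently close to $\bar x$, the iterates converge to a point in $F \cap C$ with R-linear rate $$\sqrt{c\sqrt{1-\epsilon^2}+\epsilon\sqrt{1-c^2}} < 1.$$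
   Context: For a set $S \subset \mathbf{E}$, $d_S(x) = \inf\{\|z-x\| : z \in S\}$ and $P_S(x) = \operatorname{argmin}\{\|z-x\| : z \in S\}$ is the (multivalued) projection. For a closed set $F$ and $\bar x \in F$, the normal cone is $N_F(\bar x) = \{ \lim_i t_i(x_i - z_i) : t_i \ge 0,\ x_i \to \bar x,\ z_i \in P_F(x_i)\}$. A closed set $C$ is super-regular at $\bar x \in C$ if for every $\delta > 0$ there is a neighborhood of $\bar x$ such that for all points $u, z$ in that neighborhood with $z \in C$ and all $y \in P_C(u)$, $\langle z-y, u-y\rangle \le \delta \|z-y\|\cdot\|u-y\|$. A sequence $(x_k)$ converges to $\hat x$ with R-linear rate $r \in (0,1)$ if there is a constant $K$ with $\|x_k - \hat x\| \le K r^k$ for all $k$. *)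

theory Defs
  imports "HOL-Analysis.Analysis"
begin

definition proj :: "'a::euclidean_space set \<Rightarrow> 'a \<Rightarrow> 'a set" where
  "proj S x = {y. is_arg_min (\<lambda>z. norm (z - x)) (\<lambda>z. z \<in> S) y}"

text \<open>Limiting (Mordukhovich) normal cone; only meaningful for \<open>F\<close> closed and \<open>x \<in> F\<close>.\<close>

definition normal_cone :: "'a::euclidean_space set \<Rightarrow> 'a \<Rightarrow> 'a set" where
  "normal_cone F x = {v. \<exists>(t :: nat \<Rightarrow> real) xs zs.
     (\<forall>i. 0 \<le> t i \<and> zs i \<in> proj F (xs i)) \<and> xs \<longlonglongrightarrow> x \<and>
     (\<lambda>i. t i *\<^sub>R (xs i - zs i)) \<longlonglongrightarrow> v}"

definition super_regular :: "'a::euclidean_space set \<Rightarrow> 'a \<Rightarrow> bool" where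
  "super_regular C x \<longleftrightarrow> (\<forall>\<delta>>0. \<exists>U. open U \<and> x \<in> U \<and>
     (\<forall>u\<in>U. \<forall>z\<in>U \<inter> C. \<forall>y\<in>proj C u.
        (z - y) \<bullet> (u - y) \<le> \<delta> * norm (z - y) * norm (u - y)))"

definition strongly_regular_at :: "'a::euclidean_space set \<Rightarrow> 'a set \<Rightarrow> 'a \<Rightarrow> bool" where
  "strongly_regular_at F C x \<longleftrightarrow> normal_cone F x \<inter> uminus ` normal_cone C x = {0}"

definition normal_products :: "'a::euclidean_space set \<Rightarrow> 'a set \<Rightarrow> 'a \<Rightarrow> real set" where
  "normal_products F C x =
     {u \<bullet> v | u v. u \<in> normal_cone F x \<inter> cball 0 1 \<and> v \<in> uminus ` normal_cone C x \<inter> cball 0 1}"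

text \<open>The maximum is rendered as a supremum, since \<open>Max\<close> is only specified on finite sets;
  that it is attained is part of the theorem.\<close>

definition cbar :: "'a::euclidean_space set \<Rightarrow> 'a set \<Rightarrow> 'a \<Rightarrow> real" where
  "cbar F C x = Sup (normal_products F C x)"

text \<open>The index \<open>2 * n - 1\<close> is a truncated subtraction, harmless since \<open>n \<ge> 1\<close>.\<close>

definition inexact_alt_proj ::
    "'a::euclidean_space set \<Rightarrow> 'a set \<Rightarrow> real \<Rightarrow> (nat \<Rightarrow> 'a) \<Rightarrow> bool" where
  "inexact_alt_proj F C \<epsilon> x \<longleftrightarrow> x 0 \<in> C \<and> x 1 \<in> F \<and>
     (\<forall>n\<ge>1. x (2 * n) \<in> proj C (x (2 * n - 1)) \<and>
        x (2 * n + 1) \<in> F \<and>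
        norm (x (2 * n + 1) - x (2 * n)) \<le> norm (x (2 * n) - x (2 * n - 1)) \<and>
        (x (2 * n + 1) \<noteq> x (2 * n) \<longrightarrow>
           infdist ((x (2 * n) - x (2 * n + 1)) /\<^sub>R norm (x (2 * n) - x (2 * n + 1)))
             (normal_cone F (x (2 * n + 1))) \<le> \<epsilon>))"

definition converges_R_linearly :: "(nat \<Rightarrow> 'a::real_normed_vector) \<Rightarrow> 'a \<Rightarrow> real \<Rightarrow> bool" where
  "converges_R_linearly x l r \<longleftrightarrow> 0 < r \<and> r < 1 \<and> (\<exists>K. \<forall>k. norm (x k - l) \<le> K * r ^ k)"

end

theory Submission
  imports Defs
begin

text \<open>By compactness and the outer semicontinuity of the normal cones, near \<open>xbar\<close> every unit normal
  of \<open>F\<close> at \<open>b\<close> makes an angle of at least \<open>arccos c'\<close>, for some \<open>c' < c\<close>, with the direction from \<open>b\<close>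
  to its projection \<open>d\<close> on \<open>C\<close>. The direction from \<open>b\<close> to the previous iterate \<open>a \<in> C\<close> is within
  \<open>arcsin \<epsilon>\<close> of such a normal, so it makes an angle of at least \<open>arccos c' - arcsin \<epsilon>\<close> with
  \<open>d - b\<close>. Super-regularity says that the angle at \<open>d\<close> in the triangle \<open>a b d\<close> is nearly obtuse,
  whence \<open>\<parallel>d - b\<parallel> \<le> q \<parallel>a - b\<parallel>\<close> with \<open>q = cos (arccos c - arcsin \<epsilon>)\<close>: the step length shrinks by the factor
  \<open>q\<close> over every two iterations.\<close>

section \<open>Projections and limiting normal cones\<close>

lemma projD:
  assumes "y \<in> proj S x"
  shows "y \<in> S" and "z \<in> S \<Longrightarrow> norm (y - x) \<le> norm (z - x)"
  using assms by (auto simp: proj_def is_arg_min_def not_less)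

lemma proj_self: "x \<in> S \<Longrightarrow> x \<in> proj S x"
  by (simp add: proj_def is_arg_min_def)

lemma tendsto_of_dist_less_inverse:
  fixes f :: "nat \<Rightarrow> 'a::metric_space"
  assumes "\<And>n. dist (f n) l < inverse (real (Suc n))"
  shows "f \<longlonglongrightarrow> l"
proof -
  have "(\<lambda>n. dist (f n) l) \<longlonglongrightarrow> 0"
    using assms by (intro tendsto_sandwich[OF _ _ tendsto_const LIMSEQ_inverse_real_of_nat])
      (auto intro!: always_eventually less_imp_le)
  then show ?thesis
    by (simp add: tendsto_dist_iff[symmetric])
qed

text \<open>Choosing \<open>e = inverse (Suc n)\<close> recovers the defining sequences. Without
  sequences, limits of normals can be handled with no diagonal argument.\<close>

lemma mem_normal_cone_iff:
  "v \<in> normal_cone F x \<longleftrightarrow>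
    (\<forall>e>0. \<exists>t y z. 0 \<le> t \<and> z \<in> proj F y \<and> dist y x < e \<and> dist (t *\<^sub>R (y - z)) v < e)"
    (is "?L \<longleftrightarrow> ?R")
proof
  assume ?L
  then obtain t xs zs where tz: "\<And>i. 0 \<le> t i" "\<And>i. zs i \<in> proj F (xs i)"
    and xs: "xs \<longlonglongrightarrow> x" and lim: "(\<lambda>i. t i *\<^sub>R (xs i - zs i)) \<longlonglongrightarrow> v"
    unfolding normal_cone_def by blast
  show ?R
  proof (intro allI impI)
    fix e :: real assume "e > 0"
    then have "\<forall>\<^sub>F i in sequentially. dist (xs i) x < e \<and> dist (t i *\<^sub>R (xs i - zs i)) v < e"
      using tendstoD[OF xs] tendstoD[OF lim] by (simp add: eventually_conj)
    then obtain i where "dist (xs i) x < e" "dist (t i *\<^sub>R (xs i - zs i)) v < e"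
      by (auto dest: eventually_happens)
    then show "\<exists>t y z. 0 \<le> t \<and> z \<in> proj F y \<and> dist y x < e \<and> dist (t *\<^sub>R (y - z)) v < e"
      using tz by blast
  qed
next
  assume ?R
  then have "\<forall>n. \<exists>t y z. 0 \<le> t \<and> z \<in> proj F y \<and> dist y x < inverse (real (Suc n))
      \<and> dist (t *\<^sub>R (y - z)) v < inverse (real (Suc n))"
    by simp
  then obtain t xs zs where tz: "\<And>i. 0 \<le> t i" "\<And>i. zs i \<in> proj F (xs i)"
    and xs: "\<And>i. dist (xs i) x < inverse (real (Suc i))"
    and vs: "\<And>i. dist (t i *\<^sub>R (xs i - zs i)) v < inverse (real (Suc i))"
    by metis
  show ?L
    unfolding normal_cone_def using tz tendsto_of_dist_less_inverse[OF xs]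
      tendsto_of_dist_less_inverse[OF vs] by blast
qed

text \<open>Outer semicontinuity: far enough along, a scaled projection residual that is e/2-close
  to the data at index i is e-close to the limit. The constant sequence of base points gives
  closedness of each cone.\<close>

lemma normal_cone_limit:
  assumes "xs \<longlonglongrightarrow> x" "vs \<longlonglongrightarrow> v" "\<And>i. vs i \<in> normal_cone F (xs i)"
  shows "v \<in> normal_cone F x"
  unfolding mem_normal_cone_iff
proof (intro allI impI)
  fix e :: real assume "e > 0"
  then have "\<forall>\<^sub>F i in sequentially. dist (xs i) x < e / 2 \<and> dist (vs i) v < e / 2"
    using tendstoD[OF assms(1), of "e / 2"] tendstoD[OF assms(2), of "e / 2"]
    by (intro eventually_conj) simp_all
  then obtain i where i: "dist (xs i) x < e / 2" "dist (vs i) v < e / 2"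
    by (auto dest: eventually_happens)
  obtain t y z where "0 \<le> t" "z \<in> proj F y" "dist y (xs i) < e / 2"
    "dist (t *\<^sub>R (y - z)) (vs i) < e / 2"
    using assms(3)[of i] \<open>e > 0\<close> unfolding mem_normal_cone_iff by (meson half_gt_zero)
  then show "\<exists>t y z. 0 \<le> t \<and> z \<in> proj F y \<and> dist y x < e \<and> dist (t *\<^sub>R (y - z)) v < e"
    using i dist_triangle_half_l by (meson dist_triangle_half_r dist_commute_lessI)
qed

lemma closed_normal_cone: "closed (normal_cone F x)"
  unfolding closed_sequential_limits using normal_cone_limit[OF tendsto_const] by blast

lemma zero_in_normal_cone: "x \<in> F \<Longrightarrow> 0 \<in> normal_cone F x"
  unfolding mem_normal_cone_iff using proj_self by (metis dist_self order_refl scaleR_zero_left)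

lemma normal_cone_scaleR:
  assumes "v \<in> normal_cone F x" "0 \<le> s"
  shows "s *\<^sub>R v \<in> normal_cone F x"
proof -
  obtain t xs zs where tz: "\<And>i. 0 \<le> t i" "\<And>i. zs i \<in> proj F (xs i)"
    and xs: "xs \<longlonglongrightarrow> x" and lim: "(\<lambda>i. t i *\<^sub>R (xs i - zs i)) \<longlonglongrightarrow> v"
    using assms(1) unfolding normal_cone_def by blast
  have "(\<lambda>i. (s * t i) *\<^sub>R (xs i - zs i)) \<longlonglongrightarrow> s *\<^sub>R v"
    using tendsto_scaleR[OF tendsto_const lim, of s] by simp
  then show ?thesis
    unfolding normal_cone_def using tz xs assms(2)
    by (intro CollectI exI[of _ "\<lambda>i. s * t i"] exI[of _ xs] exI[of _ zs]) simp
qed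

section \<open>The constant \<open>cbar\<close> and strong regularity\<close>

lemma normal_productsI:
  assumes "u \<in> normal_cone F x" "norm u \<le> 1" "- v \<in> normal_cone C x" "norm v \<le> 1"
  shows "u \<bullet> v \<in> normal_products F C x"
proof -
  have "v \<in> uminus ` normal_cone C x"
    using assms(3) by (metis image_eqI minus_minus)
  then show ?thesis
    unfolding normal_products_def using assms by auto
qed

text \<open>The set is the continuous image of a product of two closed bounded sets. This is what
  makes the \<open>Sup\<close> in \<open>cbar\<close> an upper bound and, once the set is nonempty,
  a maximum.\<close>

lemma compact_normal_products: "compact (normal_products F C x)"
proof -
  have "compact ((normal_cone F x \<inter> cball 0 1) \<times> (uminus ` normal_cone C x \<inter> cball 0 1))"
    by (intro compact_Times closed_Int_compact closed_normal_cone closed_negations compact_cball)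
  then have "compact ((\<lambda>p. fst p \<bullet> snd p) `
      ((normal_cone F x \<inter> cball 0 1) \<times> (uminus ` normal_cone C x \<inter> cball 0 1)))"
    by (intro compact_continuous_image continuous_intros)
  also have "(\<lambda>p. fst p \<bullet> snd p) `
      ((normal_cone F x \<inter> cball 0 1) \<times> (uminus ` normal_cone C x \<inter> cball 0 1)) = normal_products F C x"
    unfolding normal_products_def by force
  finally show ?thesis .
qed

lemma normal_products_le_cbar: "p \<in> normal_products F C x \<Longrightarrow> p \<le> cbar F C x"
  unfolding cbar_def
  by (intro cSup_upper bounded_imp_bdd_above compact_imp_bounded compact_normal_products)

lemma zero_in_normal_products:
  assumes "x \<in> F \<inter> C"
  shows "0 \<in> normal_products F C x"
  using assms normal_productsI[of 0 F x 0 C] by (simp add: zero_in_normal_cone)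

lemma cbar_attained:
  assumes "x \<in> F \<inter> C"
  shows "cbar F C x \<in> normal_products F C x"
  unfolding cbar_def
  using zero_in_normal_products[OF assms]
  by (intro closed_contains_Sup bounded_imp_bdd_above compact_imp_bounded compact_imp_closed
      compact_normal_products) auto

text \<open>The equality case of Cauchy-Schwarz in the unit ball.\<close>

lemma inner_ge_1_imp_eq:
  fixes u v :: "'a::real_inner"
  assumes "norm u \<le> 1" "norm v \<le> 1" "1 \<le> u \<bullet> v"
  shows "u = v"
proof -
  have "u \<bullet> u \<le> 1" "v \<bullet> v \<le> 1"
    using assms by (simp_all add: dot_square_norm power_le_one)
  then have "(u - v) \<bullet> (u - v) \<le> 0"
    using assms(3) by (simp add: inner_diff inner_commute)
  then show ?thesis
    by (metis eq_iff_diff_eq_0 inner_eq_zero_iff inner_ge_zero order_antisym)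
qed

text \<open>If the maximum were at least 1, its two maximisers would coincide, giving a nonzero
  vector in the intersection. Conversely, normalising a nonzero common vector produces the value
  1.\<close>

lemma strongly_regular_iff_cbar:
  assumes "x \<in> F \<inter> C"
  shows "strongly_regular_at F C x \<longleftrightarrow> cbar F C x < 1"
proof
  assume reg: "strongly_regular_at F C x"
  obtain u v where uv: "cbar F C x = u \<bullet> v" "u \<in> normal_cone F x" "norm u \<le> 1"
    "v \<in> uminus ` normal_cone C x" "norm v \<le> 1"
    using cbar_attained[OF assms] unfolding normal_products_def by auto
  show "cbar F C x < 1"
  proof (rule ccontr)
    assume "\<not> cbar F C x < 1"
    then have "1 \<le> u \<bullet> v" using uv by simp
    then have "u = v" using uv(3,5) inner_ge_1_imp_eq by blast
    then have "u = 0"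
      using reg uv(2,4) unfolding strongly_regular_at_def by blast
    then show False using \<open>1 \<le> u \<bullet> v\<close> by simp
  qed
next
  assume less: "cbar F C x < 1"
  have "v = 0" if v: "v \<in> normal_cone F x" "v \<in> uminus ` normal_cone C x" for v
  proof (rule ccontr)
    assume "v \<noteq> 0"
    have "- v \<in> normal_cone C x" using v(2) by auto
    then have "sgn (- v) \<in> normal_cone C x" "sgn v \<in> normal_cone F x"
      using v(1) by (simp_all only: sgn_div_norm normal_cone_scaleR inverse_nonnegative_iff_nonnegative norm_ge_zero)
    then have "sgn v \<bullet> sgn v \<in> normal_products F C x"
      by (intro normal_productsI) (simp_all add: sgn_minus norm_sgn)
    moreover have "sgn v \<bullet> sgn v = 1"
      using \<open>v \<noteq> 0\<close> by (simp add: dot_square_norm norm_sgn)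
    ultimately show False
      using normal_products_le_cbar less by force
  qed
  moreover have "0 \<in> normal_cone F x \<inter> uminus ` normal_cone C x"
    using assms zero_in_normal_cone[of x F] zero_in_normal_cone[of x C] by force
  ultimately show "strongly_regular_at F C x"
    unfolding strongly_regular_at_def by blast
qed

section \<open>Angles between vectors\<close>

text \<open>The triangle inequality for angles: the angle from u to v is at least the angle from w
  to v minus the angle from u to w, hence at least A - B.\<close>

lemma inner_le_cos_diff:
  fixes u v w :: "'a::real_inner"
  assumes "norm u = 1" "norm v = 1" "norm w = 1"
    and A: "w \<bullet> v \<le> cos A" "A \<le> pi" and B: "cos B \<le> u \<bullet> w" "0 \<le> B" and "B \<le> A"
  shows "u \<bullet> v \<le> cos (A - B)"
proof -
  define \<alpha> \<beta> where "\<alpha> = w \<bullet> v" and "\<beta> = u \<bullet> w"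
  have sq: "u \<bullet> u = 1" "v \<bullet> v = 1" "w \<bullet> w = 1"
    using assms by (simp_all add: dot_square_norm)
  have bounds: "\<bar>\<alpha>\<bar> \<le> 1" "\<bar>\<beta>\<bar> \<le> 1"
    using Cauchy_Schwarz_ineq2[of w v] Cauchy_Schwarz_ineq2[of u w] assms
    by (simp_all add: \<alpha>_def \<beta>_def)
  \<comment> \<open>The components orthogonal to w have the sines of the two angles as lengths, so
    Cauchy-Schwarz for them yields the cosine subtraction formula.\<close>
  have "norm (u - \<beta> *\<^sub>R w) = sqrt (1 - \<beta>\<^sup>2)" "norm (v - \<alpha> *\<^sub>R w) = sqrt (1 - \<alpha>\<^sup>2)"
    unfolding norm_eq_sqrt_inner using sq
    by (simp_all add: \<alpha>_def \<beta>_def inner_diff inner_commute power2_eq_square)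
  moreover have "(u - \<beta> *\<^sub>R w) \<bullet> (v - \<alpha> *\<^sub>R w) = u \<bullet> v - \<alpha> * \<beta>"
    using sq by (simp add: \<alpha>_def \<beta>_def inner_diff inner_commute)
  ultimately have "u \<bullet> v \<le> \<alpha> * \<beta> + sqrt (1 - \<alpha>\<^sup>2) * sqrt (1 - \<beta>\<^sup>2)"
    using norm_cauchy_schwarz[of "u - \<beta> *\<^sub>R w" "v - \<alpha> *\<^sub>R w"] by (simp add: mult.commute)
  also have "\<dots> = cos (arccos \<alpha> - arccos \<beta>)"
    using bounds by (simp add: cos_diff sin_arccos_abs cos_arccos_abs)
  also have "\<dots> \<le> cos (A - B)"
  proof (rule cos_monotone_0_pi_le)
    have "A = arccos (cos A)" "B = arccos (cos B)"
      using assms by (simp_all add: arccos_cos)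
    moreover have "arccos (cos A) \<le> arccos \<alpha>" "arccos \<beta> \<le> arccos (cos B)"
      using A(1) B(1) bounds by (auto intro!: arccos_le_arccos simp: \<alpha>_def \<beta>_def)
    ultimately show "A - B \<le> arccos \<alpha> - arccos \<beta>" by linarith
    show "arccos \<alpha> - arccos \<beta> \<le> pi"
      using bounds arccos_ubound[of \<alpha>] arccos_lbound[of \<beta>] by (simp add: abs_le_iff)
  qed (use assms in simp)
  finally show ?thesis .
qed

text \<open>A vector within \<epsilon> of the unit vector u deviates from it by an angle of at most
  arcsin \<epsilon>.\<close>

lemma inner_sgn_ge_of_norm_diff:
  fixes u w :: "'a::real_inner"
  assumes "norm u = 1" "norm (u - w) \<le> \<epsilon>" "\<epsilon> < 1"
  shows "w \<noteq> 0" "sqrt (1 - \<epsilon>\<^sup>2) \<le> u \<bullet> sgn w"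
proof -
  show w: "w \<noteq> 0" using assms by auto
  have "0 \<le> \<epsilon>" using assms(2) norm_ge_zero order_trans by blast
  define \<beta> where "\<beta> = u \<bullet> sgn w"
  have uw: "u \<bullet> w = norm w * \<beta>" using w by (simp add: \<beta>_def sgn_div_norm)
  \<comment> \<open>Pythagoras: the first summand is the squared distance from u to the line through
    w, the second is the part along that line.\<close>
  have eq: "(norm (u - w))\<^sup>2 = (1 - \<beta>\<^sup>2) + (norm w - \<beta>)\<^sup>2"
    using assms(1) uw by (simp add: power2_norm_eq_inner inner_diff inner_commute
        flip: dot_square_norm) (simp add: dot_square_norm power2_eq_square algebra_simps)
  have le: "(norm (u - w))\<^sup>2 \<le> \<epsilon>\<^sup>2" using assms(2) by (simp add: power_mono)
  have "\<epsilon>\<^sup>2 < 1" using \<open>0 \<le> \<epsilon>\<close> assms(3) by (simp add: power_less_one_iff abs_square_less_1)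
  have "1 - \<epsilon>\<^sup>2 \<le> \<beta>\<^sup>2" using eq le zero_le_power2[of "norm w - \<beta>"] by linarith
  \<comment> \<open>The bound on the square leaves the sign open. A negative value would put w at
    distance at least 1 from u.\<close>
  moreover have "0 \<le> \<beta>"
  proof (rule ccontr)
    assume "\<not> 0 \<le> \<beta>"
    then have "norm w * \<beta> \<le> 0" by (simp add: mult_nonneg_nonpos)
    then have "1 \<le> (1 - \<beta>\<^sup>2) + (norm w - \<beta>)\<^sup>2"
      using zero_le_power2[of "norm w"] unfolding power2_diff by linarith
    then show False using eq le \<open>\<epsilon>\<^sup>2 < 1\<close> by linarith
  qed
  ultimately show "sqrt (1 - \<epsilon>\<^sup>2) \<le> u \<bullet> sgn w"
    unfolding \<beta>_def using real_le_lsqrt by blast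
qed

section \<open>Contraction of one round near \<open>xbar\<close>\<close>

text \<open>Otherwise there are violating points b tending to x. Along a subsequence both unit
  vectors converge, and the limits give a normal product at x that is at least c, hence above
  \<open>cbar\<close>.\<close>

lemma normal_angle_near:
  assumes "cbar F C x < c"
  obtains \<eta> where "\<eta> > 0"
    and "\<And>b d w. \<lbrakk>dist b x < \<eta>; w \<in> normal_cone F b; norm w = 1; d \<in> proj C b; b \<noteq> d\<rbrakk>
      \<Longrightarrow> w \<bullet> sgn (d - b) \<le> c"
proof -
  have "\<exists>\<eta>>0. \<forall>b d w. dist b x < \<eta> \<and> w \<in> normal_cone F b \<and> norm w = 1 \<and> d \<in> proj C b \<and> b \<noteq> d
      \<longrightarrow> w \<bullet> sgn (d - b) \<le> c"
  proof (rule ccontr)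
    assume neg: "\<not> ?thesis"
    have "\<forall>n. \<exists>b d w. dist b x < inverse (real (Suc n)) \<and> w \<in> normal_cone F b \<and> norm w = 1
        \<and> d \<in> proj C b \<and> b \<noteq> d \<and> c < w \<bullet> sgn (d - b)"
      using neg by (metis inverse_positive_iff_positive of_nat_0_less_iff zero_less_Suc not_le)
    then obtain b d w where near: "\<And>n. dist (b n) x < inverse (real (Suc n))"
      and w: "\<And>n. w n \<in> normal_cone F (b n)" "\<And>n. norm (w n) = 1"
      and d: "\<And>n. d n \<in> proj C (b n)" "\<And>n. b n \<noteq> d n"
      and gt: "\<And>n. c < w n \<bullet> sgn (d n - b n)"
      by metis
    have blim: "b \<longlonglongrightarrow> x"
      using near by (rule tendsto_of_dist_less_inverse)
    let ?p = "\<lambda>n. (w n, sgn (d n - b n))"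
    have "compact (sphere (0::'a) 1 \<times> sphere (0::'a) 1)"
      by (intro compact_Times compact_sphere)
    moreover have "\<forall>n. ?p n \<in> sphere 0 1 \<times> sphere 0 1"
      using w d by (auto simp: norm_sgn) (metis)
    ultimately obtain p \<phi> where p: "p \<in> sphere 0 1 \<times> sphere 0 1"
      and \<phi>: "strict_mono \<phi>" and lim: "(?p \<circ> \<phi>) \<longlonglongrightarrow> p"
      by (rule seq_compactE[OF compact_imp_seq_compact])
    have wlim: "(\<lambda>n. w (\<phi> n)) \<longlonglongrightarrow> fst p" and vlim: "(\<lambda>n. sgn (d (\<phi> n) - b (\<phi> n))) \<longlonglongrightarrow> snd p"
      using tendsto_fst[OF lim] tendsto_snd[OF lim] by (simp_all add: o_def)
    have blim': "(\<lambda>n. b (\<phi> n)) \<longlonglongrightarrow> x"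
      using LIMSEQ_subseq_LIMSEQ[OF blim \<phi>] by (simp add: o_def)
    have "fst p \<in> normal_cone F x"
      using normal_cone_limit[OF blim' wlim] w by blast
    \<comment> \<open>The definition of the cone applies directly: base points b, projections d, and
      inverse distances as weights.\<close>
    moreover have "- snd p \<in> normal_cone C x"
    proof -
      have "(\<lambda>n. inverse (norm (d (\<phi> n) - b (\<phi> n))) *\<^sub>R (b (\<phi> n) - d (\<phi> n))) \<longlonglongrightarrow> - snd p"
        using tendsto_minus[OF vlim] by (simp add: sgn_div_norm scaleR_right_diff_distrib)
      then show ?thesis
        unfolding normal_cone_def using d blim'
        by (intro CollectI exI[of _ "\<lambda>n. inverse (norm (d (\<phi> n) - b (\<phi> n)))"]
            exI[of _ "\<lambda>n. b (\<phi> n)"] exI[of _ "\<lambda>n. d (\<phi> n)"]) simp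
    qed
    ultimately have "fst p \<bullet> snd p \<in> normal_products F C x"
      using p by (intro normal_productsI) (auto simp: mem_Times_iff)
    moreover have "c \<le> fst p \<bullet> snd p"
      using tendsto_inner[OF wlim vlim] gt by (intro LIMSEQ_le_const) (auto intro: less_imp_le)
    ultimately show False
      using normal_products_le_cbar assms by force
  qed
  then show ?thesis using that by blast
qed

text \<open>The bound on \<epsilon> is sin (arccos c), and c > 0 keeps arccos c in the range where
  arcsin inverts sin. So the inexactness costs less angle than regularity provides.\<close>

lemma arcsin_less_arccos:
  assumes "0 < c" "c < 1" "0 \<le> \<epsilon>" "\<epsilon> < sqrt (1 - c\<^sup>2)"
  shows "arcsin \<epsilon> < arccos c"
proof -
  have "arcsin \<epsilon> < arcsin (sqrt (1 - c\<^sup>2))"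
    using assms by (intro arcsin_less_arcsin) auto
  also have "\<dots> = arcsin (sin (arccos c))"
    using assms by (simp add: sin_arccos)
  also have "\<dots> = arccos c"
    using assms arccos_le_pi2[of c] arccos_lbound[of c] by (intro arcsin_sin) linarith+
  finally show ?thesis .
qed

text \<open>The rate formula is the cosine subtraction formula, and it is below 1 because the angle
  difference is strictly positive.\<close>

lemma rate_eq_cos:
  assumes "0 < c" "c < 1" "0 \<le> \<epsilon>" "\<epsilon> < sqrt (1 - c\<^sup>2)"
  shows "0 < c * sqrt (1 - \<epsilon>\<^sup>2) + \<epsilon> * sqrt (1 - c\<^sup>2)"
    and "c * sqrt (1 - \<epsilon>\<^sup>2) + \<epsilon> * sqrt (1 - c\<^sup>2) < 1"
    and "c * sqrt (1 - \<epsilon>\<^sup>2) + \<epsilon> * sqrt (1 - c\<^sup>2) = cos (arccos c - arcsin \<epsilon>)"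
proof -
  have "sqrt (1 - c\<^sup>2) \<le> 1" by simp
  then have \<epsilon>: "\<epsilon> < 1" using assms by linarith
  then show eq: "c * sqrt (1 - \<epsilon>\<^sup>2) + \<epsilon> * sqrt (1 - c\<^sup>2) = cos (arccos c - arcsin \<epsilon>)"
    using assms by (simp add: cos_diff sin_arccos cos_arcsin)
  have "\<epsilon>\<^sup>2 < 1" using assms(3) \<epsilon> by (simp add: abs_square_less_1)
  moreover have "0 \<le> \<epsilon> * sqrt (1 - c\<^sup>2)"
    using assms(3,4) by (intro mult_nonneg_nonneg) linarith+
  ultimately show "0 < c * sqrt (1 - \<epsilon>\<^sup>2) + \<epsilon> * sqrt (1 - c\<^sup>2)"
    using assms by (intro add_pos_nonneg mult_pos_pos) auto
  have "cos (arccos c - arcsin \<epsilon>) < cos 0"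
    using assms \<epsilon> arcsin_less_arccos[OF assms] arccos_ubound[of c] 
    by (intro cos_monotone_0_pi) (auto intro: order_trans[OF _ arccos_ubound[of c]] simp: arcsin_nonneg)
  then show "c * sqrt (1 - \<epsilon>\<^sup>2) + \<epsilon> * sqrt (1 - c\<^sup>2) < 1" using eq by simp
qed

text \<open>Here a is the current point of C, b the next point of F, and d the projection of b back
  onto C.\<close>

lemma alternating_step_contraction:
  assumes "super_regular C x" "x \<in> F \<inter> C" "cbar F C x < c" "c < 1"
    and "0 \<le> \<epsilon>" "\<epsilon> < sqrt (1 - c\<^sup>2)"
  obtains \<eta> where "\<eta> > 0"
    and "\<And>a b d. \<lbrakk>a \<in> C; b \<in> F; d \<in> proj C b; dist a x < \<eta>; dist b x < \<eta>;
        a \<noteq> b \<longrightarrow> infdist ((a - b) /\<^sub>R norm (a - b)) (normal_cone F b) \<le> \<epsilon>\<rbrakk>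
      \<Longrightarrow> norm (d - b) \<le> cos (arccos c - arcsin \<epsilon>) * norm (a - b)"
proof -
  define \<theta> \<phi> q where "\<theta> = arccos c" and "\<phi> = arcsin \<epsilon>" and "q = cos (\<theta> - \<phi>)"
  \<comment> \<open>An intermediate value between \<open>cbar\<close> and c: the angle estimate
    holds with c', and the resulting gap between q' and q pays for the error from
    super-regularity.\<close>
  define c' where "c' = (cbar F C x + c) / 2"
  have c0: "0 \<le> cbar F C x"
    using normal_products_le_cbar zero_in_normal_products assms by blast
  have c': "0 \<le> c'" "cbar F C x < c'" "c' < c"
    using c0 assms by (auto simp: c'_def)
  have "sqrt (1 - c\<^sup>2) \<le> 1" by simp
  then have \<epsilon>1: "\<epsilon> < 1" using assms by linarith
  have \<phi>: "0 \<le> \<phi>" "cos \<phi> = sqrt (1 - \<epsilon>\<^sup>2)"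
    using assms \<epsilon>1 by (auto simp: \<phi>_def cos_arcsin arcsin_nonneg)
  have "0 < c" using c' by linarith
  have "\<phi> < \<theta>"
    unfolding \<phi>_def \<theta>_def using \<open>0 < c\<close> assms by (intro arcsin_less_arccos)
  define \<theta>' where "\<theta>' = arccos c'"
  have \<theta>': "\<theta> < \<theta>'" "\<theta>' \<le> pi" "cos \<theta>' = c'"
    using c' assms by (auto simp: \<theta>_def \<theta>'_def intro!: arccos_less_arccos arccos_ubound)
  define q' where "q' = cos (\<theta>' - \<phi>)"
  have "q' < q"
    unfolding q_def q'_def using \<theta>' \<phi> \<open>\<phi> < \<theta>\<close> by (intro cos_monotone_0_pi) auto
  \<comment> \<open>Half the gap, because \<open>norm (a - d)\<close> may be as large as twice
    \<open>norm (a - b)\<close>.\<close>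
  define \<delta> where "\<delta> = (q - q') / 2"
  have "\<delta> > 0" using \<open>q' < q\<close> by (simp add: \<delta>_def)
  then obtain U where U: "open U" "x \<in> U"
    "\<And>u z y. \<lbrakk>u \<in> U; z \<in> U; z \<in> C; y \<in> proj C u\<rbrakk>
      \<Longrightarrow> (z - y) \<bullet> (u - y) \<le> \<delta> * norm (z - y) * norm (u - y)"
    using assms(1) unfolding super_regular_def by (metis IntI)
  obtain \<eta>1 where \<eta>1: "\<eta>1 > 0" "ball x \<eta>1 \<subseteq> U"
    using U openE by blast
  obtain \<eta>2 where \<eta>2: "\<eta>2 > 0"
    "\<And>b d w. \<lbrakk>dist b x < \<eta>2; w \<in> normal_cone F b; norm w = 1; d \<in> proj C b; b \<noteq> d\<rbrakk>
      \<Longrightarrow> w \<bullet> sgn (d - b) \<le> c'"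
    using normal_angle_near[OF c'(2)] by blast
  show ?thesis
  proof (rule that[of "min \<eta>1 \<eta>2"])
    show "min \<eta>1 \<eta>2 > 0" using \<eta>1 \<eta>2 by simp
    fix a b d
    assume ab: "a \<in> C" "b \<in> F" and d: "d \<in> proj C b"
      and near: "dist a x < min \<eta>1 \<eta>2" "dist b x < min \<eta>1 \<eta>2"
      and inex: "a \<noteq> b \<longrightarrow> infdist ((a - b) /\<^sub>R norm (a - b)) (normal_cone F b) \<le> \<epsilon>"
    have dab: "norm (d - b) \<le> norm (a - b)" using projD[OF d] ab by blast
    show "norm (d - b) \<le> cos (arccos c - arcsin \<epsilon>) * norm (a - b)"
    proof (cases "d = b")
      case True
      have "0 \<le> q"
        using rate_eq_cos[of c \<epsilon>] \<open>0 < c\<close> assms by (simp add: q_def \<theta>_def \<phi>_def)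
      then show ?thesis using True by (simp add: q_def \<theta>_def \<phi>_def)
    next
      case False
      then have "a \<noteq> b" using dab by auto
      have ua: "norm (sgn (a - b)) = 1" using \<open>a \<noteq> b\<close> by (simp add: norm_sgn)
      have "normal_cone F b \<noteq> {}" using zero_in_normal_cone ab by blast
      \<comment> \<open>The distance is attained since the cone is closed and nonempty. The length
        of w is arbitrary, so only its direction is used below.\<close>
      then obtain w where w: "w \<in> normal_cone F b"
        and "infdist (sgn (a - b)) (normal_cone F b) = dist (sgn (a - b)) w"
        using infdist_attains_inf[OF closed_normal_cone] by blast
      then have dw: "norm (sgn (a - b) - w) \<le> \<epsilon>"
        using inex \<open>a \<noteq> b\<close> by (simp add: sgn_div_norm dist_norm)
      have w': "w \<noteq> 0" "cos \<phi> \<le> sgn (a - b) \<bullet> sgn w"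
        using inner_sgn_ge_of_norm_diff[OF ua dw \<epsilon>1] \<phi>(2) by simp_all
      have "sgn w \<in> normal_cone F b"
        using w by (simp add: sgn_div_norm normal_cone_scaleR)
      then have "sgn w \<bullet> sgn (d - b) \<le> cos \<theta>'"
        using \<eta>2(2)[of b "sgn w" d] near d False w' \<theta>'(3) by (auto simp: norm_sgn)
      then have "sgn (a - b) \<bullet> sgn (d - b) \<le> q'"
        unfolding q'_def using ua False w' \<theta>' \<phi> \<open>\<phi> < \<theta>\<close>
        by (intro inner_le_cos_diff[of _ _ "sgn w"]) (auto simp: norm_sgn)
      then have angle: "(a - b) \<bullet> (d - b) \<le> q' * (norm (a - b) * norm (d - b))"
        using \<open>a \<noteq> b\<close> False by (simp add: sgn_div_norm divide_simps mult.commute)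
      have "a \<in> U" "b \<in> U"
        using near \<eta>1 by (auto simp: dist_commute subset_iff)
      then have "(a - d) \<bullet> (b - d) \<le> \<delta> * norm (a - d) * norm (b - d)"
        using U(3) ab d by blast
      also have "\<dots> \<le> \<delta> * (2 * norm (a - b)) * norm (b - d)"
      proof -
        have "norm (a - d) \<le> 2 * norm (a - b)"
          using norm_triangle_ineq4[of "a - b" "d - b"] dab by simp
        then show ?thesis using \<open>\<delta> > 0\<close> by (intro mult_right_mono mult_left_mono) auto
      qed
      finally have sr: "(a - d) \<bullet> (b - d) \<le> (q - q') * (norm (a - b) * norm (d - b))"
        by (simp add: \<delta>_def norm_minus_commute field_simps)
      \<comment> \<open>The squared step splits into a term governed by the angle at b and one
        governed by super-regularity at d. Their bounds add up to q, and one factor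
        \<open>norm (d - b)\<close> cancels.\<close>
      have "norm (d - b) * norm (d - b) = (a - b) \<bullet> (d - b) + (a - d) \<bullet> (b - d)"
        unfolding power2_eq_square[symmetric] power2_norm_eq_inner
        by (simp add: inner_diff inner_commute)
      also have "\<dots> \<le> q * norm (a - b) * norm (d - b)"
        using angle sr by (simp add: algebra_simps)
      finally have "norm (d - b) \<le> q * norm (a - b)"
        using False by simp
      then show ?thesis by (simp add: q_def \<theta>_def \<phi>_def)
    qed
  qed
qed

section \<open>From shrinking steps to R-linear convergence\<close>

lemma geometric_steps_converge:
  fixes x :: "nat \<Rightarrow> 'a::banach"
  assumes "0 \<le> r" "r < 1" and step: "\<And>k. norm (x (Suc k) - x k) \<le> M * r ^ k"
  obtains l where "x \<longlonglongrightarrow> l" "\<And>k. norm (x k - l) \<le> M / (1 - r) * r ^ k"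
proof -
  have "summable (\<lambda>k. x (Suc k) - x k)"
  proof (rule summable_comparison_test')
    show "summable (\<lambda>k. M * r ^ k)"
      using assms by (intro summable_mult summable_geometric) simp
  qed (use step in blast)
  then have "convergent (\<lambda>n. \<Sum>k<n. x (Suc k) - x k)"
    by (simp add: summable_iff_convergent)
  then have "convergent (\<lambda>n. x n - x 0)"
    by (simp add: sum_lessThan_telescope)
  then obtain l' where "(\<lambda>n. x n - x 0) \<longlonglongrightarrow> l'" by (auto simp: convergent_def)
  from tendsto_add[OF this tendsto_const[of "x 0"]]
  have lim: "x \<longlonglongrightarrow> l' + x 0" by simp
  have M: "0 \<le> M" using order_trans[OF norm_ge_zero step[of 0]] by simp
  \<comment> \<open>The right-hand side is the exact sum of m geometric terms, which lets the
    induction close.\<close>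
  have tail: "norm (x k - x (k + m)) \<le> M / (1 - r) * r ^ k * (1 - r ^ m)" for k m
  proof (induction m)
    case (Suc m)
    have "norm (x k - x (k + Suc m)) \<le> norm (x k - x (k + m)) + norm (x (Suc (k + m)) - x (k + m))"
      using norm_triangle_ineq4[of "x k - x (k + m)" "x (Suc (k + m)) - x (k + m)"] by simp
    also have "\<dots> \<le> M / (1 - r) * r ^ k * (1 - r ^ m) + M * r ^ (k + m)"
      using Suc step by (intro add_mono)
    also have "\<dots> = M / (1 - r) * r ^ k * (1 - r ^ Suc m)"
      using assms(2) by (simp add: field_simps power_add)
    finally show ?case .
  qed simp
  have "norm (x k - (l' + x 0)) \<le> M / (1 - r) * r ^ k" for k
  proof (rule LIMSEQ_le_const2)
    show "(\<lambda>m. norm (x k - x (m + k))) \<longlonglongrightarrow> norm (x k - (l' + x 0))"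
      by (intro tendsto_intros LIMSEQ_ignore_initial_segment lim)
    have "M / (1 - r) * r ^ k * (1 - r ^ m) \<le> M / (1 - r) * r ^ k * 1" for m
      using M assms by (intro mult_left_mono) auto
    then show "\<exists>N. \<forall>m\<ge>N. norm (x k - x (m + k)) \<le> M / (1 - r) * r ^ k"
      using tail[of k] by (metis add.commute mult.right_neutral order_trans)
  qed
  then show ?thesis using that lim by blast
qed

text \<open>The contraction is available only within \<eta> of \<open>xbar\<close>, so decay of the
  steps and confinement of the iterates have to be proved together.\<close>

lemma inexact_alt_proj_steps:
  assumes x: "inexact_alt_proj F C \<epsilon> x" and xbar: "xbar \<in> F \<inter> C"
    and contr: "\<And>a b d. \<lbrakk>a \<in> C; b \<in> F; d \<in> proj C b; dist a xbar < \<eta>; dist b xbar < \<eta>;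
        a \<noteq> b \<longrightarrow> infdist ((a - b) /\<^sub>R norm (a - b)) (normal_cone F b) \<le> \<epsilon>\<rbrakk>
      \<Longrightarrow> norm (d - b) \<le> q * norm (a - b)"
    and q: "0 < q" "q < 1" and near: "norm (x 1 - xbar) < \<eta> * (1 - q) / 3"
  shows "norm (x (2 * n + 2) - x (2 * n + 1)) \<le> q ^ n * norm (x 2 - x 1)"
proof -
  define D where "D = norm (x 2 - x 1)"
  \<comment> \<open>The iteration at index n + 1, which removes the truncated subtraction.\<close>
  have it: "x (2 * n + 2) \<in> proj C (x (2 * n + 1))" "x (2 * n + 1) \<in> F"
     "norm (x (2 * n + 3) - x (2 * n + 2)) \<le> norm (x (2 * n + 2) - x (2 * n + 1))"
     "x (2 * n + 3) \<noteq> x (2 * n + 2) \<longrightarrow>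
        infdist ((x (2 * n + 2) - x (2 * n + 3)) /\<^sub>R norm (x (2 * n + 2) - x (2 * n + 3)))
          (normal_cone F (x (2 * n + 3))) \<le> \<epsilon>" for n
  proof -
    have ix: "2 * Suc n = 2 * n + 2" "2 * n + 2 - 1 = 2 * n + 1" "2 * n + 2 + 1 = 2 * n + 3"
      by simp_all
    have *: "\<And>n. n \<ge> 1 \<Longrightarrow> x (2 * n) \<in> proj C (x (2 * n - 1)) \<and>
        x (2 * n + 1) \<in> F \<and>
        norm (x (2 * n + 1) - x (2 * n)) \<le> norm (x (2 * n) - x (2 * n - 1)) \<and>
        (x (2 * n + 1) \<noteq> x (2 * n) \<longrightarrow>
           infdist ((x (2 * n) - x (2 * n + 1)) /\<^sub>R norm (x (2 * n) - x (2 * n + 1)))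
             (normal_cone F (x (2 * n + 1))) \<le> \<epsilon>)"
      using x unfolding inexact_alt_proj_def by blast
    note *[of "Suc n", unfolded ix]
    then show "x (2 * n + 2) \<in> proj C (x (2 * n + 1))"
     "norm (x (2 * n + 3) - x (2 * n + 2)) \<le> norm (x (2 * n + 2) - x (2 * n + 1))"
     "x (2 * n + 3) \<noteq> x (2 * n + 2) \<longrightarrow>
        infdist ((x (2 * n + 2) - x (2 * n + 3)) /\<^sub>R norm (x (2 * n + 2) - x (2 * n + 3)))
          (normal_cone F (x (2 * n + 3))) \<le> \<epsilon>"
      by simp_all
    show "x (2 * n + 1) \<in> F"
      using x *[of n] unfolding inexact_alt_proj_def by (cases n) simp_all
  qed
  \<comment> \<open>\<open>xbar\<close> lies in C and so competes with \<open>x 2\<close> in the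
    projection of \<open>x 1\<close>.\<close>
  have D: "D \<le> norm (x 1 - xbar)"
    using projD(2)[OF it(1)[of 0], of xbar] xbar by (simp add: D_def norm_minus_commute numeral_2_eq_2)
  \<comment> \<open>Round n makes two steps of length at most \<open>q ^ n * D\<close>; the last
    summand is the total of these lengths over the first n rounds.\<close>
  have "norm (x (2 * n + 2) - x (2 * n + 1)) \<le> q ^ n * D \<and>
    norm (x (2 * n + 1) - xbar) \<le> norm (x 1 - xbar) + 2 * D * (1 - q ^ n) / (1 - q)"
  proof (induction n)
    case 0
    show ?case by (simp add: D_def numeral_2_eq_2)
  next
    case (Suc n)
    let ?b = "x (2 * n + 1)" and ?c = "x (2 * n + 2)" and ?d = "x (2 * n + 3)" and ?e = "x (2 * n + 4)"
    have cd: "norm (?d - ?c) \<le> q ^ n * D" using it(3)[of n] Suc by linarith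
    have "norm (?d - xbar) \<le> norm (?d - ?c) + norm (?c - ?b) + norm (?b - xbar)"
      by norm
    also have "\<dots> \<le> q ^ n * D + q ^ n * D + (norm (x 1 - xbar) + 2 * D * (1 - q ^ n) / (1 - q))"
      using Suc cd by linarith
    also have "\<dots> = norm (x 1 - xbar) + 2 * D * (1 - q ^ Suc n) / (1 - q)"
      using q by (simp add: field_simps)
    finally have d: "norm (?d - xbar) \<le> norm (x 1 - xbar) + 2 * D * (1 - q ^ Suc n) / (1 - q)" .
    have "norm (?c - xbar) \<le> norm (?c - ?b) + norm (?b - xbar)"
      by norm
    \<comment> \<open>A spare step length is added so that \<open>?c\<close> obeys the same bound as
      \<open>?d\<close>.\<close>
    also have "\<dots> \<le> q ^ n * D + q ^ n * D + (norm (x 1 - xbar) + 2 * D * (1 - q ^ n) / (1 - q))"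
    proof -
      have "0 \<le> q ^ n * D" using q by (simp add: D_def)
      then show ?thesis using Suc by linarith
    qed
    also have "\<dots> = norm (x 1 - xbar) + 2 * D * (1 - q ^ Suc n) / (1 - q)"
      using q by (simp add: field_simps)
    finally have c: "norm (?c - xbar) \<le> norm (x 1 - xbar) + 2 * D * (1 - q ^ Suc n) / (1 - q)" .
    \<comment> \<open>Origin of the 3 in the radius: the initial distance counts once and D, at most
      that distance, counts twice, all over 1 - q.\<close>
    have "2 * D * (1 - q ^ Suc n) / (1 - q) \<le> 2 * D / (1 - q)"
      using q by (intro divide_right_mono) (simp_all add: D_def mult_left_le)
    also have "norm (x 1 - xbar) + \<dots> \<le> norm (x 1 - xbar) * (3 / (1 - q))"
    proof -
      have "0 \<le> norm (x 1 - xbar) * q" using q by simp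
      then have "norm (x 1 - xbar) * (1 - q) + 2 * D \<le> norm (x 1 - xbar) * 3"
        using D by (simp add: algebra_simps)
      then have "(norm (x 1 - xbar) * (1 - q) + 2 * D) / (1 - q) \<le> norm (x 1 - xbar) * 3 / (1 - q)"
        using q by (intro divide_right_mono) simp_all
      then show ?thesis using q by (simp add: add_divide_distrib)
    qed
    also have "\<dots> < \<eta>"
      using near q by (simp add: field_simps)
    finally have lt: "norm (x 1 - xbar) + 2 * D * (1 - q ^ Suc n) / (1 - q) < \<eta>" by simp
    have "norm (?e - ?d) \<le> q * norm (?c - ?d)"
    proof (rule contr)
      show "?c \<in> C" using projD(1)[OF it(1)[of n]] .
      show "?d \<in> F" "?e \<in> proj C ?d"
        using it(1,2)[of "Suc n"] by (simp_all add: eval_nat_numeral)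
      show "dist ?c xbar < \<eta>" "dist ?d xbar < \<eta>"
        using c d lt by (simp_all add: dist_norm)
    qed (use it(4)[of n] in auto)
    also have "\<dots> \<le> q * (q ^ n * D)"
      using cd q by (simp add: norm_minus_commute)
    finally show ?case using d by (simp add: eval_nat_numeral)
  qed
  then show ?thesis by (simp add: D_def)
qed

text \<open>A factor q over two steps is a factor sqrt q per step; the odd iterates keep the limit
  in F, the even ones in C.\<close>

lemma inexact_alt_proj_converges:
  fixes x :: "nat \<Rightarrow> 'a::euclidean_space"
  assumes "closed F" "closed C" and x: "inexact_alt_proj F C \<epsilon> x" and q: "0 < q" "q < 1"
    and steps: "\<And>n. norm (x (2 * n + 2) - x (2 * n + 1)) \<le> q ^ n * D"
  shows "\<exists>l\<in>F \<inter> C. converges_R_linearly x l (sqrt q)"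
proof -
  define r where "r = sqrt q"
  have r: "0 < r" "r < 1" "r\<^sup>2 = q" using q by (simp_all add: r_def)
  have D: "0 \<le> D" using order_trans[OF norm_ge_zero steps[of 0]] by simp
  \<comment> \<open>The first entry covers the initial step from \<open>x 0\<close> to
    \<open>x 1\<close>. The second absorbs the index shift: for k = 2n + 2, \<open>q ^ n * D\<close>
    equals \<open>D / q * r ^ k\<close>.\<close>
  define M where "M = max (norm (x 1 - x 0)) (D / q)"
  have M: "0 \<le> M" by (simp add: M_def le_max_iff_disj)
  have "norm (x (Suc k) - x k) \<le> M * r ^ k" for k
  proof -
    consider "k = 0" | n where "k = 2 * n + 1" | n where "k = 2 * n + 2"
      by (metis evenE oddE gr0_implies_Suc not_gr0 mult_Suc_right add.commute mult_eq_0_iff)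
    then show ?thesis
    proof cases
      case 2
      have "norm (x (Suc k) - x k) \<le> q ^ n * D" using steps[of n] 2 by simp
      also have "\<dots> = r ^ (2 * n) * D" using r by (simp add: power_mult)
      also have "\<dots> = D / q * r * r ^ k" using r q 2 by (simp add: power2_eq_square field_simps)
      also have "\<dots> \<le> M * 1 * r ^ k"
        using r D q M by (intro mult_right_mono mult_mono) (auto simp: M_def)
      finally show ?thesis by simp
    next
      case 3
      have "norm (x (Suc k) - x k) \<le> norm (x (2 * n + 2) - x (2 * n + 1))"
        using x 3 unfolding inexact_alt_proj_def by (auto dest!: spec[of _ "Suc n"])
      also have "\<dots> \<le> q ^ n * D" by (rule steps)
      also have "\<dots> = r ^ (2 * n) * D" using r by (simp add: power_mult)
      also have "\<dots> = D / q * r ^ k" using r q 3 by (simp add: power2_eq_square field_simps)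
      also have "\<dots> \<le> M * r ^ k"
        using r by (intro mult_right_mono) (auto simp: M_def)
      finally show ?thesis .
    qed (simp add: M_def)
  qed
  then obtain l where l: "x \<longlonglongrightarrow> l" "\<And>k. norm (x k - l) \<le> M / (1 - r) * r ^ k"
    using geometric_steps_converge[of r x M] r by auto
  have "x (2 * n + 1) \<in> F" for n
    using x unfolding inexact_alt_proj_def by (cases n) auto
  moreover have "(\<lambda>n. x (2 * n + 1)) \<longlonglongrightarrow> l"
    using LIMSEQ_subseq_LIMSEQ[OF l(1), of "\<lambda>n. 2 * n + 1"] by (simp add: strict_mono_def o_def)
  ultimately have "l \<in> F" using \<open>closed F\<close> by (rule closed_sequentially[rotated])
  have "x (2 * n) \<in> C" for n
  proof (cases "n = 0")
    case False
    then have "x (2 * n) \<in> proj C (x (2 * n - 1))"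
      using x unfolding inexact_alt_proj_def by simp
    then show ?thesis by (rule projD)
  qed (use x in \<open>simp add: inexact_alt_proj_def\<close>)
  moreover have "(\<lambda>n. x (2 * n)) \<longlonglongrightarrow> l"
    using LIMSEQ_subseq_LIMSEQ[OF l(1), of "\<lambda>n. 2 * n"] by (simp add: strict_mono_def o_def)
  ultimately have "l \<in> C" using \<open>closed C\<close> by (rule closed_sequentially[rotated])
  moreover have "converges_R_linearly x l (sqrt q)"
    unfolding converges_R_linearly_def r_def[symmetric] using l(2) r by blast
  ultimately show ?thesis using \<open>l \<in> F\<close> by blast
qed

section \<open>Local convergence of inexact alternating projections\<close>

theorem theorem6p1:
  fixes F C :: "'a::euclidean_space set" and xbar :: 'a
  assumes "closed F" and "closed C" and "xbar \<in> F \<inter> C"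
    and "super_regular C xbar"
  shows "cbar F C xbar \<in> normal_products F C xbar \<and>
    (strongly_regular_at F C xbar \<longleftrightarrow> cbar F C xbar < 1) \<and>
    (strongly_regular_at F C xbar \<longrightarrow>
      (\<forall>c \<epsilon>. cbar F C xbar < c \<and> c < 1 \<and> 0 \<le> \<epsilon> \<and> \<epsilon> < sqrt (1 - c\<^sup>2) \<longrightarrow>
        sqrt (c * sqrt (1 - \<epsilon>\<^sup>2) + \<epsilon> * sqrt (1 - c\<^sup>2)) < 1 \<and>
        (\<exists>\<rho>>0. \<forall>x. inexact_alt_proj F C \<epsilon> x \<and>
            norm (x 0 - xbar) < \<rho> \<and> norm (x 1 - xbar) < \<rho> \<longrightarrow>
          (\<exists>l \<in> F \<inter> C. converges_R_linearly x l
             (sqrt (c * sqrt (1 - \<epsilon>\<^sup>2) + \<epsilon> * sqrt (1 - c\<^sup>2)))))))"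
proof (intro conjI impI allI)
  show "cbar F C xbar \<in> normal_products F C xbar"
    using assms(3) by (rule cbar_attained)
  show "strongly_regular_at F C xbar \<longleftrightarrow> cbar F C xbar < 1"
    using assms(3) by (rule strongly_regular_iff_cbar)
next
  fix c \<epsilon> :: real
  assume "cbar F C xbar < c \<and> c < 1 \<and> 0 \<le> \<epsilon> \<and> \<epsilon> < sqrt (1 - c\<^sup>2)"
  then have c: "cbar F C xbar < c" "c < 1" and \<epsilon>: "0 \<le> \<epsilon>" "\<epsilon> < sqrt (1 - c\<^sup>2)" by auto
  \<comment> \<open>Zero is a normal product, which forces c > 0 as the angle formulas
    require.\<close>
  have "0 \<le> cbar F C xbar"
    using normal_products_le_cbar zero_in_normal_products assms(3) by blast
  then have "0 < c" using c by linarith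
  define q where "q = c * sqrt (1 - \<epsilon>\<^sup>2) + \<epsilon> * sqrt (1 - c\<^sup>2)"
  have q: "0 < q" "q < 1" "q = cos (arccos c - arcsin \<epsilon>)"
    using rate_eq_cos[OF \<open>0 < c\<close> c(2) \<epsilon>] by (simp_all add: q_def)
  then have r: "0 < sqrt q" "sqrt q < 1" by simp_all
  then show "sqrt (c * sqrt (1 - \<epsilon>\<^sup>2) + \<epsilon> * sqrt (1 - c\<^sup>2)) < 1" by (simp add: q_def)
  obtain \<eta> where \<eta>: "\<eta> > 0" and contr: "\<And>a b d. \<lbrakk>a \<in> C; b \<in> F; d \<in> proj C b;
      dist a xbar < \<eta>; dist b xbar < \<eta>;
      a \<noteq> b \<longrightarrow> infdist ((a - b) /\<^sub>R norm (a - b)) (normal_cone F b) \<le> \<epsilon>\<rbrakk>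
    \<Longrightarrow> norm (d - b) \<le> q * norm (a - b)"
    using alternating_step_contraction[OF assms(4,3) c \<epsilon>] q(3) by metis
  show "\<exists>\<rho>>0. \<forall>x. inexact_alt_proj F C \<epsilon> x \<and> norm (x 0 - xbar) < \<rho> \<and> norm (x 1 - xbar) < \<rho> \<longrightarrow>
      (\<exists>l \<in> F \<inter> C. converges_R_linearly x l (sqrt (c * sqrt (1 - \<epsilon>\<^sup>2) + \<epsilon> * sqrt (1 - c\<^sup>2))))"
    unfolding q_def[symmetric]
  proof (intro exI[of _ "\<eta> * (1 - q) / 3"] conjI allI impI)
    show "0 < \<eta> * (1 - q) / 3" using \<eta> q by simp
    fix x
    assume "inexact_alt_proj F C \<epsilon> x \<and> norm (x 0 - xbar) < \<eta> * (1 - q) / 3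
      \<and> norm (x 1 - xbar) < \<eta> * (1 - q) / 3"
    then have x: "inexact_alt_proj F C \<epsilon> x" and near: "norm (x 1 - xbar) < \<eta> * (1 - q) / 3" by auto
    note steps = inexact_alt_proj_steps[OF x assms(3) contr q(1,2) near]
    show "\<exists>l\<in>F \<inter> C. converges_R_linearly x l (sqrt q)"
      by (rule inexact_alt_proj_converges[OF assms(1,2) x q(1,2) steps])
  qed
qed

end
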